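(* Let $K\subseteq\mathbb{R}^n$ be a closed set and $h:\mathbb{R}^n\to\mathbb{R}\cup\{\pm\infty\}$ a proper function such that $K\subseteq\operatorname{dom}h$. Suppose that $\overline{x}\in\operatorname{argmin}_K h$ and that $K$ is star-shaped at $\overline{x}$. Let $\gamma\ge 0$. If $h$ is (strongly) star quasiconvex on $K$ with modulus $\gamma$ with respect to $\overline{x}$, then for every $y\in K$ and every $z=\overline{x}+t(y-\overline{x})$ with $0<t\le 1$, $$h(z)\le h(y)-\frac{\gamma}{4}(1-t^2)\|y-\overline{x}\|^2\quad\Big(=h(y)-\frac{\gamma}{4}\big(\|y-\overline{x}\|^2-\|z-\overline{x}\|^2\big)\Big).\qquad( * )$$ Conversely, if $h$ is continuous and $( * )$ holds for every $y\in K$ and every $z=\overline{x}+t(y-\overline{x})$ with $0<t\le1$, then $h$ is (strongly) star quasiconvex on $K$ with the same modulus $\gamma$ with respect to $\overline{x}$.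
   Context: $h$ is proper if $\operatorname{dom}h:=\{x: h(x)<+\infty\}\neq\emptyset$ and $h>-\infty$ everywhere. $\operatorname{argmin}_K h$ is the set of minimizers of $h$ over $K$. $K$ is star-shaped at $\overline{x}\in K$ if $[\overline{x},x]\subseteq K$ for every $x\in K$. For $\gamma\ge0$, $h$ is (strongly) star quasiconvex on $K$ with modulus $\gamma$ with respect to $\overline{x}\in\operatorname{argmin}_K h$ if for every $y\in K$ and $\lambda\in[0,1]$, $$h(\lambda\overline{x}+(1-\lambda)y)\le h(y)-\lambda(1-\lambda)\frac{\gamma}{2}\|y-\overline{x}\|^2$$ ("strongly" corresponds to $\gamma>0$). *)

theory Defs
  imports "HOL-Analysis.Analysis"
begin

definition effective_dom :: "('a \<Rightarrow> ereal) \<Rightarrow> 'a set" where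
  "effective_dom h = {x. h x < \<infinity>}"

definition proper_fun :: "('a \<Rightarrow> ereal) \<Rightarrow> bool" where
  "proper_fun h \<longleftrightarrow> effective_dom h \<noteq> {} \<and> (\<forall>x. h x > -\<infinity>)"

definition argmin_on :: "'a set \<Rightarrow> ('a \<Rightarrow> ereal) \<Rightarrow> 'a set" where
  "argmin_on K h = {x. is_arg_min h (\<lambda>y. y \<in> K) x}"

text \<open>The library predicate \<^const>\<open>starlike\<close> only asserts that some centre exists;
  here the centre is prescribed.\<close>

definition star_shaped_at :: "'a::real_vector set \<Rightarrow> 'a \<Rightarrow> bool" where
  "star_shaped_at K a \<longleftrightarrow> a \<in> K \<and> (\<forall>x\<in>K. closed_segment a x \<subseteq> K)"

text \<open>The case \<open>\<gamma> = 0\<close> is star quasiconvexity, \<open>\<gamma> > 0\<close> is strong star quasiconvexity.\<close>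

definition star_quasiconvex_on ::
  "'a::real_normed_vector set \<Rightarrow> ('a \<Rightarrow> ereal) \<Rightarrow> real \<Rightarrow> 'a \<Rightarrow> bool" where
  "star_quasiconvex_on K h \<gamma> a \<longleftrightarrow>
     \<gamma> \<ge> 0 \<and> a \<in> argmin_on K h \<and>
     (\<forall>y\<in>K. \<forall>u\<in>{0..1}.
        h (u *\<^sub>R a + (1 - u) *\<^sub>R y)
          \<le> h y - ereal (u * (1 - u) * (\<gamma> / 2) * (norm (y - a))\<^sup>2))"

end

theory Submission
  imports Defs
begin

text \<open>Along the ray \<open>s \<mapsto> xbar + s (y - xbar)\<close>, with \<open>c = \<gamma> \<parallel>y - xbar\<parallel>\<^sup>2\<close>, star quasiconvexity bounds
  the growth of \<open>h\<close> from \<open>a\<close> to \<open>b\<close> below by \<open>c/2 a (b - a)\<close>, whereas (*) asks for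
  \<open>c/4 (b\<^sup>2 - a\<^sup>2)\<close>; the two differ by the nonnegative term \<open>c/4 (b - a)\<^sup>2\<close>. Hence (*) implies star
  quasiconvexity directly, except at \<open>xbar\<close> itself, where minimality is used.
  Conversely, summing the star quasiconvexity bound over a partition of \<open>[t, 1]\<close> into \<open>N\<close> equal
  pieces leaves an error of order \<open>1/N\<close>.\<close>

text \<open>Over N equal pieces of width (b - a)/N, each drop of \<open>f\<close> is at most C ((b -
  a)/N)^2. The drops telescope to a total of at most C (b - a)^2 / N, which tends to 0.\<close>

lemma le_if_quadratic_defect:
  fixes f :: "real \<Rightarrow> real"
  assumes "a \<le> b"
    and defect: "\<And>x y. a \<le> x \<Longrightarrow> x \<le> y \<Longrightarrow> y \<le> b \<Longrightarrow> f x - f y \<le> C * (y - x)\<^sup>2"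
  shows "f a \<le> f b"
proof -
  have bound: "f a - f b \<le> C * (b - a)\<^sup>2 * inverse (real (Suc n))" for n
  proof -
    define N where "N = real (Suc n)"
    define d where "d = (b - a) / N"
    have N: "N > 0" and Nd: "N * d = b - a" by (simp_all add: N_def d_def)
    have d: "d \<ge> 0" using assms(1) N by (simp add: d_def)
    have "f a - f (a + real i * d) \<le> real i * (C * d\<^sup>2)" if "i \<le> Suc n" for i
      using that
    proof (induction i)
      case (Suc i)
      \<comment> \<open>This keeps the right end of the next piece at or below \<open>b\<close>, so
        \<open>defect\<close> applies to it.\<close>
      have "real (Suc i) * d \<le> N * d"
        using Suc.prems d by (intro mult_right_mono) (auto simp: N_def)
      then have "f (a + real i * d) - f (a + real (Suc i) * d) \<le> C * d\<^sup>2"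
        using defect[of "a + real i * d" "a + real (Suc i) * d"] d Nd
        by (simp add: algebra_simps)
      then show ?case using Suc by (simp add: algebra_simps)
    qed simp
    from this[of "Suc n"] have "f a - f b \<le> N * (C * d\<^sup>2)"
      unfolding N_def[symmetric] Nd by simp
    also have "\<dots> = C * (b - a)\<^sup>2 * inverse N"
      using N by (simp add: d_def power2_eq_square field_simps)
    finally show ?thesis by (simp add: N_def)
  qed
  have "(\<lambda>n. C * (b - a)\<^sup>2 * inverse (real (Suc n))) \<longlonglongrightarrow> C * (b - a)\<^sup>2 * 0"
    by (intro tendsto_mult tendsto_const LIMSEQ_inverse_real_of_nat)
  then have "f a - f b \<le> C * (b - a)\<^sup>2 * 0"
    by (rule LIMSEQ_le_const) (use bound in blast)
  then show ?thesis by simp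
qed

lemma star_shaped_at_ray:
  assumes "star_shaped_at K a" "y \<in> K" "0 \<le> s" "s \<le> 1"
  shows "a + s *\<^sub>R (y - a) \<in> K"
proof -
  have "a + s *\<^sub>R (y - a) = (1 - s) *\<^sub>R a + s *\<^sub>R y" by (simp add: algebra_simps)
  then have "a + s *\<^sub>R (y - a) \<in> closed_segment a y"
    using assms(3,4) by (auto simp: in_segment)
  then show ?thesis using assms(1,2) by (auto simp: star_shaped_at_def)
qed

lemma argmin_on_le: "a \<in> argmin_on K h \<Longrightarrow> y \<in> K \<Longrightarrow> h a \<le> h y"
  by (auto simp: argmin_on_def is_arg_min_def not_less)

lemma star_quasiconvex_on_ray_le:
  assumes fin: "\<And>x. x \<in> K \<Longrightarrow> \<bar>h x\<bar> \<noteq> \<infinity>"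
    and star: "star_shaped_at K a"
    and qc: "star_quasiconvex_on K h \<gamma> a"
    and y: "y \<in> K" and t: "0 \<le> t" "t \<le> 1"
  shows "h (a + t *\<^sub>R (y - a)) \<le> h y - ereal (\<gamma> / 4 * (1 - t\<^sup>2) * (norm (y - a))\<^sup>2)"
proof -
  define p where "p s = a + s *\<^sub>R (y - a)" for s
  \<comment> \<open>\<open>fin\<close> makes \<open>h\<close> finite on \<open>K\<close>, so
    \<open>r\<close> represents \<open>h\<close> faithfully for parameters in [0, 1], and the
    estimates can be done in the reals.\<close>
  define r where "r s = real_of_ereal (h (p s))" for s
  define c where "c = \<gamma> * (norm (y - a))\<^sup>2"
  have h_p: "h (p s) = ereal (r s)" and p_in: "p s \<in> K" if "0 \<le> s" "s \<le> 1" for s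
    using star_shaped_at_ray[OF star y that] fin[of "p s"]
    by (auto simp: r_def p_def ereal_real)
  have step: "r x \<le> r s - c / 2 * x * (s - x)" if "0 \<le> x" "x \<le> s" "s \<le> 1" for x s
  proof (cases "s = 0")
    case False
    \<comment> \<open>Star quasiconvexity is applied at \<open>p s\<close> rather than at
      \<open>y\<close>; \<open>u\<close> is the weight on \<open>a\<close> that places
      \<open>p x\<close> on the segment from \<open>a\<close> to \<open>p s\<close>. For s = 0 also
      x = 0, and the bound is trivial.\<close>
    define u where "u = 1 - x / s"
    have s: "s > 0" and u: "u \<in> {0..1}" and x: "x = (1 - u) * s"
      using that False by (auto simp: u_def field_simps)
    have p_x: "p x = u *\<^sub>R a + (1 - u) *\<^sub>R p s"
      unfolding x p_def by (simp add: algebra_simps)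
    have "h (p x) \<le> h (p s) - ereal (u * (1 - u) * (\<gamma> / 2) * (norm (p s - a))\<^sup>2)"
      unfolding p_x using qc p_in[of s] u s that unfolding star_quasiconvex_on_def by auto
    then have "r x \<le> r s - u * (1 - u) * (\<gamma> / 2) * (norm (p s - a))\<^sup>2"
      using h_p[of x] h_p[of s] that by simp
    \<comment> \<open>The norm contributes s^2, and (1 - u) s = x, u s = s - x.\<close>
    also have "u * (1 - u) * (\<gamma> / 2) * (norm (p s - a))\<^sup>2 = c / 2 * x * (s - x)"
    proof -
      have "norm (p s - a) = s * norm (y - a)" using s by (simp add: p_def)
      then show ?thesis
        unfolding x c_def by (simp add: algebra_simps power2_eq_square)
    qed
    finally show ?thesis .
  qed (use that in auto)
  \<comment> \<open>Subtracting c/4 s^2 turns \<open>step\<close> into a quadratic defect, because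
    c/4 (s^2 - x^2) - c/2 x (s - x) = c/4 (s - x)^2.\<close>
  have "r t - c / 4 * t\<^sup>2 \<le> r 1 - c / 4 * 1\<^sup>2"
  proof (rule le_if_quadratic_defect[where f = "\<lambda>s. r s - c / 4 * s\<^sup>2" and C = "c / 4"])
    fix x s assume "t \<le> x" "x \<le> s" "s \<le> 1"
    then show "r x - c / 4 * x\<^sup>2 - (r s - c / 4 * s\<^sup>2) \<le> c / 4 * (s - x)\<^sup>2"
      using step[of x s] t by (simp add: power2_eq_square field_simps)
  qed (use t in auto)
  then have "ereal (r t) \<le> ereal (r 1) - ereal (\<gamma> / 4 * (1 - t\<^sup>2) * (norm (y - a))\<^sup>2)"
    by (simp add: c_def field_simps)
  moreover have "p 1 = y" by (simp add: p_def)
  ultimately show ?thesis using h_p[of t] h_p[of 1] t by (simp add: p_def)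
qed

lemma star_quasiconvex_onI_ray:
  assumes "\<gamma> \<ge> 0" and min: "a \<in> argmin_on K h"
    and ray: "\<And>y t. y \<in> K \<Longrightarrow> 0 < t \<Longrightarrow> t \<le> 1 \<Longrightarrow>
      h (a + t *\<^sub>R (y - a)) \<le> h y - ereal (\<gamma> / 4 * (1 - t\<^sup>2) * (norm (y - a))\<^sup>2)"
  shows "star_quasiconvex_on K h \<gamma> a"
  unfolding star_quasiconvex_on_def
proof (intro conjI ballI)
  fix y and u :: real
  assume y: "y \<in> K" and u: "u \<in> {0..1}"
  show "h (u *\<^sub>R a + (1 - u) *\<^sub>R y) \<le> h y - ereal (u * (1 - u) * (\<gamma> / 2) * (norm (y - a))\<^sup>2)"
  \<comment> \<open>The weight \<open>u\<close> on \<open>a\<close> corresponds to the ray parameter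
    t = 1 - u. At u = 1 this is 0, outside the range of \<open>ray\<close>.\<close>
  proof (cases "u = 1")
    case True
    then show ?thesis using argmin_on_le[OF min y] by simp
  next
    case False
    define k where "k = \<gamma> / 4 * (norm (y - a))\<^sup>2"
    have "u *\<^sub>R a + (1 - u) *\<^sub>R y = a + (1 - u) *\<^sub>R (y - a)" by (simp add: algebra_simps)
    then have "h (u *\<^sub>R a + (1 - u) *\<^sub>R y)
        \<le> h y - ereal (\<gamma> / 4 * (1 - (1 - u)\<^sup>2) * (norm (y - a))\<^sup>2)"
      using ray[OF y, of "1 - u"] u False by simp
    also have "\<dots> \<le> h y - ereal (u * (1 - u) * (\<gamma> / 2) * (norm (y - a))\<^sup>2)"
    proof -
      \<comment> \<open>The gap between the two subtracted terms is k u^2, since (1 - (1 - u)^2) - 2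
        u (1 - u) = u^2.\<close>
      have "0 \<le> k * u\<^sup>2" using assms(1) by (simp add: k_def)
      also have "\<dots> = \<gamma> / 4 * (1 - (1 - u)\<^sup>2) * (norm (y - a))\<^sup>2
          - u * (1 - u) * (\<gamma> / 2) * (norm (y - a))\<^sup>2"
        by (simp add: k_def power2_eq_square field_simps)
      finally show ?thesis by (intro ereal_minus_mono) auto
    qed
    finally show ?thesis .
  qed
qed (use assms in auto)

theorem corollary16:
  fixes K :: "(real ^ 'n) set"
    and h :: "real ^ 'n \<Rightarrow> ereal"
    and xbar :: "real ^ 'n"
    and \<gamma> :: real
  assumes "closed K"
    and "proper_fun h"
    and "K \<subseteq> effective_dom h"
    and "xbar \<in> argmin_on K h"
    and "star_shaped_at K xbar"
    and "\<gamma> \<ge> 0"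
  shows "(star_quasiconvex_on K h \<gamma> xbar \<longrightarrow>
        (\<forall>y\<in>K. \<forall>t z. 0 < t \<and> t \<le> 1 \<and> z = xbar + t *\<^sub>R (y - xbar) \<longrightarrow>
          h z \<le> h y - ereal (\<gamma> / 4 * (1 - t\<^sup>2) * (norm (y - xbar))\<^sup>2))) \<and>
      (\<forall>y\<in>K. \<forall>t z. 0 < t \<and> t \<le> 1 \<and> z = xbar + t *\<^sub>R (y - xbar) \<longrightarrow>
          h y - ereal (\<gamma> / 4 * (1 - t\<^sup>2) * (norm (y - xbar))\<^sup>2)
            = h y - ereal (\<gamma> / 4 * ((norm (y - xbar))\<^sup>2 - (norm (z - xbar))\<^sup>2))) \<and>
      (continuous_on UNIV h \<and>
        (\<forall>y\<in>K. \<forall>t z. 0 < t \<and> t \<le> 1 \<and> z = xbar + t *\<^sub>R (y - xbar) \<longrightarrow>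
          h z \<le> h y - ereal (\<gamma> / 4 * (1 - t\<^sup>2) * (norm (y - xbar))\<^sup>2)) \<longrightarrow>
        star_quasiconvex_on K h \<gamma> xbar)"
proof (intro conjI)
  have fin: "\<bar>h x\<bar> \<noteq> \<infinity>" if "x \<in> K" for x
    using that assms(2,3) by (force simp: proper_fun_def effective_dom_def)
  show "star_quasiconvex_on K h \<gamma> xbar \<longrightarrow>
      (\<forall>y\<in>K. \<forall>t z. 0 < t \<and> t \<le> 1 \<and> z = xbar + t *\<^sub>R (y - xbar) \<longrightarrow>
        h z \<le> h y - ereal (\<gamma> / 4 * (1 - t\<^sup>2) * (norm (y - xbar))\<^sup>2))"
    using star_quasiconvex_on_ray_le[where h = h, OF fin assms(5)] by auto
\<comment> \<open>The two forms of the bound agree because the distance from \<open>z\<close> to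
  \<open>xbar\<close> is t times that from \<open>y\<close> to \<open>xbar\<close>.\<close>
qed (auto intro: star_quasiconvex_onI_ray[OF assms(6,4)]
    simp: power_mult_distrib left_diff_distrib right_diff_distrib mult.assoc)

end
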